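(* Let $k$ be an algebraically closed field of arbitrary characteristic, let $R=k[[X_1,\ldots,X_n]]$ with maximal ideal $\mathfrak m$, and let $f\in\mathfrak m$ be such that $\tau(f)<\infty$. Then $\mu(f)<\infty$ if and only if $f\in\sqrt{J(f)}$.
   Context: For $f\in R$, write $f_{X_i}=\partial f/\partial X_i$. The Jacobian ideal is $J(f)=\langle f_{X_1},\ldots,f_{X_n}\rangle\subset R$ and the Tjurina ideal is $T(f)=\langle f\rangle+J(f)$. The Milnor number is $\mu(f)=\dim_k R/J(f)\in\mathbb N\cup\{\infty\}$ and the Tjurina number is $\tau(f)=\dim_k R/T(f)\in\mathbb N\cup\{\infty\}$. $\sqrt{I}$ denotes the radical of the ideal $I$. *)

theory Defs
  imports
    "HOL-Algebra.Algebraic_Closure_Type"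
    "HOL-Algebra.Embedded_Algebras"
    "HOL-Algebra.QuotRing"
    "HOL-Library.Extended_Nat"
    "HOL-Library.Function_Algebras"
begin

section \<open>Formal power series in finitely many variables\<close>

text \<open>
  The variables \<open>X\<^sub>1, \<dots>, X\<^sub>n\<close> are indexed by a finite type \<open>'n\<close>, so \<open>n = CARD('n) \<ge> 1\<close>.
  A series is the family of its coefficients; the exponent \<open>m :: 'n \<Rightarrow> nat\<close> stands for the
  monomial \<open>\<Prod>i. X\<^sub>i ^ m i\<close>. Exponents are added pointwise.
\<close>

typedef (overloaded) ('a, 'n) mfps = "UNIV :: (('n \<Rightarrow> nat) \<Rightarrow> 'a) set"
  morphisms mfps_nth Abs_mfps ..

lemma mfps_nth_Abs [simp]: "mfps_nth (Abs_mfps c) = c"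
  by (simp add: Abs_mfps_inverse)

lemma mfps_eqI: "(\<And>m. mfps_nth f m = mfps_nth g m) \<Longrightarrow> f = g"
  by (metis ext mfps_nth_inverse)

lemma finite_exponent_sums:
  "finite {(a, b). a + b = (m :: 'n::finite \<Rightarrow> nat)}"
proof (rule finite_subset)
  show "{(a, b). a + b = m} \<subseteq> PiE UNIV (\<lambda>i. {..m i}) \<times> PiE UNIV (\<lambda>i. {..m i})"
    by (auto simp: PiE_def)
qed (intro finite_cartesian_product finite_PiE; simp)

instantiation mfps :: (comm_ring_1, finite) comm_ring_1
begin

definition "0 = Abs_mfps (\<lambda>_. 0)"
definition "1 = Abs_mfps (\<lambda>m. if m = 0 then 1 else 0)"
definition "f + g = Abs_mfps (\<lambda>m. mfps_nth f m + mfps_nth g m)"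
definition "f - g = Abs_mfps (\<lambda>m. mfps_nth f m - mfps_nth g m)"
definition "- f = Abs_mfps (\<lambda>m. - mfps_nth f m)"
definition "f * g = Abs_mfps (\<lambda>m. \<Sum>(a, b)\<in>{(a, b). a + b = m}. mfps_nth f a * mfps_nth g b)"

instance
proof
  fix f g h :: "('a, 'b) mfps"
  show "f * g * h = f * (g * h)"
  proof (rule mfps_eqI)
    fix m :: "'b \<Rightarrow> nat"
    let ?f = "mfps_nth f" and ?g = "mfps_nth g" and ?h = "mfps_nth h"
    let ?S = "\<lambda>m :: 'b \<Rightarrow> nat. {(a, b). a + b = m}"
    have "mfps_nth (f * g * h) m =
        (\<Sum>p\<in>?S m. \<Sum>q\<in>?S (fst p). ?f (fst q) * ?g (snd q) * ?h (snd p))"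
      by (simp add: times_mfps_def case_prod_beta sum_distrib_right)
    also have "\<dots> = (\<Sum>(p, q)\<in>Sigma (?S m) (\<lambda>p. ?S (fst p)). ?f (fst q) * ?g (snd q) * ?h (snd p))"
      by (rule sum.Sigma) (auto simp: finite_exponent_sums)
    also have "\<dots> = (\<Sum>(p, q)\<in>Sigma (?S m) (\<lambda>p. ?S (snd p)). ?f (fst p) * (?g (fst q) * ?h (snd q)))"
      by (rule sum.reindex_bij_witness[where
            i = "\<lambda>((a, p), (b, c)). ((a + b, c), (a, b))" and
            j = "\<lambda>((p, c), (a, b)). ((a, b + c), (b, c))"])
         (auto simp: add.assoc mult.assoc)
    also have "\<dots> = (\<Sum>p\<in>?S m. \<Sum>q\<in>?S (snd p). ?f (fst p) * (?g (fst q) * ?h (snd q)))"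
      by (rule sum.Sigma[symmetric]) (auto simp: finite_exponent_sums)
    also have "\<dots> = mfps_nth (f * (g * h)) m"
      by (simp add: times_mfps_def case_prod_beta sum_distrib_left)
    finally show "mfps_nth (f * g * h) m = mfps_nth (f * (g * h)) m" .
  qed
  show "f * g = g * f"
    unfolding times_mfps_def
    by (intro arg_cong[where f = Abs_mfps] ext
          sum.reindex_bij_witness[where i = prod.swap and j = prod.swap])
       (auto simp: ac_simps)
  show "1 * f = f"
  proof (rule mfps_eqI)
    fix m :: "'b \<Rightarrow> nat"
    have "mfps_nth (1 * f) m =
        (\<Sum>p\<in>{(a, b). a + b = m}. if p = (0, m) then mfps_nth f m else 0)"
      unfolding times_mfps_def one_mfps_def mfps_nth_Abs
      by (rule sum.cong) (auto split: if_splits)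
    then show "mfps_nth (1 * f) m = mfps_nth f m"
      by (simp add: finite_exponent_sums)
  qed
  show "(f + g) * h = f * h + g * h"
    by (rule mfps_eqI)
       (simp add: times_mfps_def plus_mfps_def case_prod_beta distrib_right sum.distrib)
  have "mfps_nth 0 0 \<noteq> mfps_nth (1 :: ('a, 'b) mfps) 0"
    by (simp add: zero_mfps_def one_mfps_def)
  then show "(0 :: ('a, 'b) mfps) \<noteq> 1"
    by metis
qed (rule mfps_eqI;
     simp add: zero_mfps_def plus_mfps_def minus_mfps_def uminus_mfps_def algebra_simps)+

end

definition mfps_const :: "'a \<Rightarrow> ('a::zero, 'n) mfps" where
  "mfps_const c = Abs_mfps (\<lambda>m. if m = 0 then c else 0)"

definition mfps_pderiv :: "'n \<Rightarrow> ('a::comm_semiring_1, 'n) mfps \<Rightarrow> ('a, 'n) mfps" where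
  "mfps_pderiv i f = Abs_mfps (\<lambda>m. of_nat (m i + 1) * mfps_nth f (m(i := m i + 1)))"

abbreviation mfps_ring :: "('a::comm_ring_1, 'n::finite) mfps ring" where
  "mfps_ring \<equiv> ring_of_type_algebra"

definition mfps_max_ideal :: "('a::zero, 'n) mfps set" where
  "mfps_max_ideal = {f. mfps_nth f 0 = 0}"


subsection \<open>The ring of power series over a field is local\<close>

lemma mfps_nth_0_mult [simp]: "mfps_nth (f * g) 0 = mfps_nth f 0 * mfps_nth g 0"
  for f g :: "('a::comm_ring_1, 'n::finite) mfps"
proof -
  have "{(a, b). a + b = (0 :: 'n \<Rightarrow> nat)} = {(0, 0)}"
    by (auto simp: fun_eq_iff)
  then show ?thesis
    by (simp add: times_mfps_def)
qed

function mfps_inverse_coeff :: "('a::field, 'n::finite) mfps \<Rightarrow> ('n \<Rightarrow> nat) \<Rightarrow> 'a" where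
  "mfps_inverse_coeff f m =
     (if m = 0 then inverse (mfps_nth f 0)
      else - inverse (mfps_nth f 0) *
        (\<Sum>p\<in>{(a, b). a + b = m} - {(0, m)}. mfps_nth f (fst p) * mfps_inverse_coeff f (snd p)))"
  by auto
termination
proof (relation "measure (\<lambda>(f, m). sum m UNIV)")
  fix m :: "'n::finite \<Rightarrow> nat" and p
  assume p: "p \<in> {(a, b). a + b = m} - {(0, m)}"
  then have m: "m = fst p + snd p" and "fst p \<noteq> 0"
    by auto
  then obtain i where "fst p i > 0"
    by (auto simp: fun_eq_iff)
  then have "sum (fst p) UNIV > 0"
    by (meson UNIV_I finite member_le_sum le0 order_less_le_trans)
  then show "((f :: ('a::field, 'n) mfps, snd p), (f, m)) \<in> measure (\<lambda>(f, m). sum m UNIV)" for f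
    by (simp add: m sum.distrib)
qed simp

declare mfps_inverse_coeff.simps [simp del]

lemma mfps_unit:
  fixes f :: "('a::field, 'n::finite) mfps"
  assumes "mfps_nth f 0 \<noteq> 0"
  obtains g where "g * f = 1"
proof
  let ?g = "mfps_inverse_coeff f"
  have "f * Abs_mfps ?g = 1"
  proof (rule mfps_eqI)
    fix m :: "'n \<Rightarrow> nat"
    show "mfps_nth (f * Abs_mfps ?g) m = mfps_nth 1 m"
    proof (cases "m = 0")
      case True
      then show ?thesis
        using assms by (simp add: one_mfps_def mfps_inverse_coeff.simps)
    next
      case False
      let ?S = "{(a, b). a + b = m}"
      have "mfps_nth (f * Abs_mfps ?g) m = (\<Sum>p\<in>?S. mfps_nth f (fst p) * ?g (snd p))"
        by (simp add: times_mfps_def case_prod_beta)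
      also have "\<dots> = mfps_nth f 0 * ?g m + (\<Sum>p\<in>?S - {(0, m)}. mfps_nth f (fst p) * ?g (snd p))"
        by (subst sum.remove[of _ "(0, m)"]) (auto simp: finite_exponent_sums)
      also have "\<dots> = 0"
        using assms False by (subst mfps_inverse_coeff.simps) simp
      finally show ?thesis
        using False by (simp add: one_mfps_def)
    qed
  qed
  then show "Abs_mfps ?g * f = 1"
    by (simp add: mult.commute)
qed

lemma ideal_mfps_max_ideal:
  "ideal mfps_max_ideal (mfps_ring :: ('a::field, 'n::finite) mfps ring)"
proof -
  let ?R = "mfps_ring :: ('a, 'n) mfps ring"
  interpret cring ?R ..
  have inv: "\<ominus>\<^bsub>?R\<^esub> x = - x" for x
    by (rule minus_equality) (simp_all add: ring_of_type_algebra_def)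
  show ?thesis
  proof (rule idealI)
    show "ring ?R" ..
    show "subgroup mfps_max_ideal (add_monoid ?R)"
    proof (rule add.subgroupI)
      have "0 \<in> (mfps_max_ideal :: ('a, 'n) mfps set)"
        by (simp add: mfps_max_ideal_def zero_mfps_def)
      then show "mfps_max_ideal \<noteq> ({} :: ('a, 'n) mfps set)"
        by blast
    next
      show "\<ominus>\<^bsub>?R\<^esub> x \<in> mfps_max_ideal" if "x \<in> mfps_max_ideal" for x
        using that by (simp add: inv mfps_max_ideal_def uminus_mfps_def)
    qed (auto simp: ring_of_type_algebra_def mfps_max_ideal_def plus_mfps_def)
  qed (auto simp: ring_of_type_algebra_def mfps_max_ideal_def)
qed

lemma maximalideal_mfps_ring_iff:
  "maximalideal M (mfps_ring :: ('a::field, 'n::finite) mfps ring) \<longleftrightarrow> M = mfps_max_ideal"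
proof -
  let ?R = "mfps_ring :: ('a, 'n) mfps ring"
  have R: "carrier ?R = UNIV" "monoid.mult ?R = (*)" "one ?R = 1"
    by (simp_all add: ring_of_type_algebra_def)
  have sub: "J \<subseteq> mfps_max_ideal" if J: "ideal J ?R" "J \<noteq> UNIV" for J
  proof
    fix f assume f: "f \<in> J"
    show "f \<in> mfps_max_ideal"
    proof (rule ccontr)
      assume "f \<notin> mfps_max_ideal"
      then obtain g where "g * f = 1"
        using mfps_unit[of f] by (auto simp: mfps_max_ideal_def)
      then have "1 \<in> J"
        using ideal.I_l_closed[OF J(1) f, of g] by (simp add: R)
      then have "J = UNIV"
        using ideal.one_imp_carrier[OF J(1)] by (simp add: R)
      with J(2) show False by simp
    qed
  qed
  have "1 \<notin> (mfps_max_ideal :: ('a, 'n) mfps set)"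
    by (simp add: mfps_max_ideal_def one_mfps_def)
  then have ne: "(mfps_max_ideal :: ('a, 'n) mfps set) \<noteq> UNIV"
    by blast
  show ?thesis
  proof
    assume M: "maximalideal M ?R"
    then have "ideal M ?R" and "M \<noteq> UNIV"
      using maximalideal.axioms(1)[OF M] maximalideal.I_notcarr[OF M] by (auto simp: R)
    then show "M = mfps_max_ideal"
      using maximalideal.I_maximal[OF M ideal_mfps_max_ideal] sub ne by (auto simp: R)
  next
    assume "M = mfps_max_ideal"
    moreover have "maximalideal mfps_max_ideal ?R"
      using ideal_mfps_max_ideal ne sub by (intro maximalidealI) (auto simp: R)
    ultimately show "maximalideal M ?R"
      by simp
  qed
qed


section \<open>Milnor and Tjurina numbers\<close>

definition ideal_radical :: "('a, 'b) ring_scheme \<Rightarrow> 'a set \<Rightarrow> 'a set" where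
  "ideal_radical R I = {x \<in> carrier R. \<exists>n::nat. n > 0 \<and> x [^]\<^bsub>R\<^esub> n \<in> I}"

definition jacobian_ideal :: "('a::comm_ring_1, 'n::finite) mfps \<Rightarrow> ('a, 'n) mfps set" where
  "jacobian_ideal f = Idl\<^bsub>mfps_ring\<^esub> (range (\<lambda>i. mfps_pderiv i f))"

definition tjurina_ideal :: "('a::comm_ring_1, 'n::finite) mfps \<Rightarrow> ('a, 'n) mfps set" where
  "tjurina_ideal f = (Idl\<^bsub>mfps_ring\<^esub> {f}) <+>\<^bsub>mfps_ring\<^esub> jacobian_ideal f"

text \<open>
  The dimension of \<open>R/I\<close> as a vector space over the coefficient field, which acts on the quotient
  through the images of the constant series. For \<open>I = R\<close> these images collapse to \<open>{0}\<close>, which is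
  not a subfield; the definition of \<^const>\<open>ring.dimension\<close> still assigns dimension 0 to the
  zero ring in this case, and nothing else.
\<close>

definition quotient_dim :: "('a::field, 'n::finite) mfps set \<Rightarrow> enat" where
  "quotient_dim I =
     (let Q = mfps_ring Quot I;
          K = range (\<lambda>c. I +>\<^bsub>mfps_ring\<^esub> mfps_const c)
      in if ring.finite_dimension Q K (carrier Q)
         then enat (ring.dim Q K (carrier Q)) else \<infinity>)"

definition milnor_number :: "('a::field, 'n::finite) mfps \<Rightarrow> enat" where
  "milnor_number f = quotient_dim (jacobian_ideal f)"

definition tjurina_number :: "('a::field, 'n::finite) mfps \<Rightarrow> enat" where
  "tjurina_number f = quotient_dim (tjurina_ideal f)"

end

theory Submission
  imports Defs
begin

text \<open>
  If \<open>f ^ N \<in> J(f)\<close> and \<open>V\<close> is a finite-dimensional complement of \<open>T(f) = f R + J(f)\<close>,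
  then iterating \<open>R = V + f R + J(f)\<close> gives \<open>R = V + f V + \<dots> + f ^ (N - 1) V + J(f)\<close>.
  Conversely, if \<open>R / J(f)\<close> has finite dimension, then among finitely many powers of \<open>f\<close> some
  \<open>f ^ e\<close> is modulo \<open>J(f)\<close> a combination of higher powers; so
  \<open>f ^ e * (1 - f * g) \<in> J(f)\<close> for some \<open>g\<close>, and \<open>1 - f * g\<close> is a unit because \<open>f \<in> \<mm>\<close>.
\<close>

section \<open>Exchange and linear dependence modulo a set of vectors\<close>

text \<open>Steinitz exchange relative to \<open>W\<close>: since \<open>v\<close> is not in
  \<open>span W\<close>, any expression of \<open>v\<close> uses some \<open>s\<close> from
  \<open>S\<close> with nonzero coefficient, and it can be solved for that \<open>s\<close>.\<close>

lemma (in vector_space) exchange_mod: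
  assumes "finite S" "v \<in> span (S \<union> W)" "v \<notin> span W"
  obtains s where "s \<in> S" "s \<in> span (insert v (S - {s} \<union> W))"
proof -
  have "\<exists>s\<in>S. s \<in> span (insert v (S - {s} \<union> W))"
    using assms(1,2)
  proof (induction S rule: finite_induct)
    case empty
    then show ?case using assms(3) by simp
  next
    case (insert s S)
    show ?case
    proof (cases "v \<in> span (S \<union> W)")
      case True
      then obtain t where t: "t \<in> S" "t \<in> span (insert v (S - {t} \<union> W))"
        using insert.IH by blast
      have "insert v (S - {t} \<union> W) \<subseteq> insert v (insert s S - {t} \<union> W)"
        by blast
      then show ?thesis
        using t span_mono by blast
    next
      case False
      \<comment> \<open>Here \<open>v\<close> is reached only after adding \<open>s\<close>, so the
        coefficient of \<open>s\<close> is nonzero.\<close>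
      then have "s \<in> span (insert v (S \<union> W))"
        using in_span_insert[of v s "S \<union> W"] insert.prems by simp
      then show ?thesis
        using insert.hyps by simp
    qed
  qed
  then show ?thesis
    using that by blast
qed

text \<open>The vectors \<open>v 0\<close>, ..., \<open>v (card S)\<close> outnumber the generators
  modulo \<open>W\<close>. The conclusion names a vector depending on its predecessors only, so that
  the order of the sequence can be exploited later. In the induction \<open>v 0\<close> replaces an
  element of \<open>S\<close> but is put into \<open>W\<close>, which shrinks \<open>S\<close> and
  shifts the sequence by one.\<close>

lemma (in vector_space) dependent_mod:
  assumes "finite S" "span (S \<union> W) = UNIV"
  shows "\<exists>i\<le>card S. v i \<in> span (v ` {..<i} \<union> W)"
  using assms
proof (induction "card S" arbitrary: S W v)
  case 0
  then show ?case by auto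
next
  case (Suc n)
  show ?case
  proof (cases "v 0 \<in> span W")
    case True
    then show ?thesis by auto
  next
    case False
    have "v 0 \<in> span (S \<union> W)"
      using Suc.prems by simp
    then obtain s where s: "s \<in> S" "s \<in> span (insert (v 0) (S - {s} \<union> W))"
      using exchange_mod[OF Suc.prems(1) _ False] by blast
    let ?S = "S - {s}" and ?W = "insert (v 0) W"
    have "S \<union> W \<subseteq> insert s (?S \<union> ?W)"
      by blast
    then have "span (insert s (?S \<union> ?W)) = UNIV"
      using Suc.prems(2) span_mono by blast
    moreover have "s \<in> span (?S \<union> ?W)"
      using s(2) by simp
    ultimately have "span (?S \<union> ?W) = UNIV"
      by (simp only: span_redundant)
    moreover have "card ?S = n" "finite ?S"
      using Suc.hyps(2) Suc.prems(1) s(1) by simp_all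
    ultimately obtain i where
      i: "i \<le> n" "v (Suc i) \<in> span ((\<lambda>i. v (Suc i)) ` {..<i} \<union> ?W)"
      using Suc.hyps(1)[of ?S ?W "\<lambda>i. v (Suc i)"] by blast
    have "(\<lambda>i. v (Suc i)) ` {..<i} \<union> ?W = v ` {..<Suc i} \<union> W"
      by (simp add: lessThan_Suc_eq_insert_0 image_image)
    then show ?thesis
      using i Suc.hyps(2) by (intro exI[of _ "Suc i"]) auto
  qed
qed

section \<open>Power series as a vector space over the coefficient field\<close>

lemma mfps_nth_const_mult [simp]:
  "mfps_nth (mfps_const c * f) m = c * mfps_nth f m"
  for f :: "('a::comm_ring_1, 'n::finite) mfps"
proof -
  have "mfps_nth (mfps_const c * f) m =
      (\<Sum>p\<in>{(a, b). a + b = m}. if p = (0, m) then c * mfps_nth f m else 0)"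
    unfolding times_mfps_def mfps_const_def mfps_nth_Abs
    by (rule sum.cong) (auto split: if_splits)
  then show ?thesis
    by (simp add: finite_exponent_sums)
qed

lemma mfps_nth_add [simp]: "mfps_nth (f + g) m = mfps_nth f m + mfps_nth g m"
  for f g :: "('a::comm_ring_1, 'n::finite) mfps"
  by (simp add: plus_mfps_def)

lemma mfps_nth_const: "mfps_nth (mfps_const c) m = (if m = 0 then c else 0)"
  by (simp add: mfps_const_def)

global_interpretation mfps: vector_space "\<lambda>c f :: ('a::field, 'n::finite) mfps. mfps_const c * f"
proof
  fix a b :: 'a and x y :: "('a, 'n) mfps"
  show "mfps_const (a + b) * x = mfps_const a * x + mfps_const b * x"
    "mfps_const a * (mfps_const b * x) = mfps_const (a * b) * x"
    "mfps_const 1 * x = x"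
    by (rule mfps_eqI; simp add: distrib_right mult.assoc)+
  show "mfps_const a * (x + y) = mfps_const a * x + mfps_const a * y"
    by (rule distrib_left)
qed

lemma mfps_ring_simps [simp]:
  "carrier mfps_ring = UNIV" "monoid.mult mfps_ring = (*)" "one mfps_ring = 1"
  "ring.add mfps_ring = (+)" "zero mfps_ring = 0"
  by (simp_all add: ring_of_type_algebra_def)

lemma mfps_ring_pow [simp]: "x [^]\<^bsub>mfps_ring\<^esub> (n::nat) = x ^ n"
  for x :: "('a::comm_ring_1, 'n::finite) mfps"
proof -
  interpret cring "mfps_ring :: ('a, 'n) mfps ring" ..
  show ?thesis
    by (induction n) (simp_all add: mult.commute)
qed

lemma mfps_ring_ideal:
  assumes "ideal I (mfps_ring :: ('a::field, 'n::finite) mfps ring)"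
  shows "0 \<in> I" "x \<in> I \<Longrightarrow> y \<in> I \<Longrightarrow> x + y \<in> I" "x \<in> I \<Longrightarrow> a * x \<in> I" "mfps.subspace I"
proof -
  interpret ideal I "mfps_ring :: ('a, 'n) mfps ring" by fact
  show 0: "0 \<in> I"
    using additive_subgroup.zero_closed[OF ideal.axioms(1)[OF assms]] by simp
  show add: "x + y \<in> I" if "x \<in> I" "y \<in> I" for x y
    using additive_subgroup.a_closed[OF ideal.axioms(1)[OF assms] that] by simp
  show mult: "a * x \<in> I" if "x \<in> I" for a x
    using I_l_closed[OF that, of a] by simp
  show "mfps.subspace I"
    using 0 add mult by (intro mfps.subspaceI)
qed

section \<open>Finite-dimensional quotients and finite spanning sets modulo an ideal\<close>

lemma mfps_const_ring_hom:
  "mfps_const \<in> ring_hom ring_of_type_algebra (mfps_ring :: ('a::field, 'n::finite) mfps ring)"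
proof (rule ring_hom_memI)
  fix a b :: 'a
  show "mfps_const (a \<otimes>\<^bsub>ring_of_type_algebra\<^esub> b) =
      mfps_const a \<otimes>\<^bsub>mfps_ring :: ('a, 'n) mfps ring\<^esub> mfps_const b"
    by (rule mfps_eqI) (simp add: ring_of_type_algebra_def mfps_nth_const)
qed (auto intro!: mfps_eqI simp: ring_of_type_algebra_def mfps_nth_const one_mfps_def)

text \<open>The image of a field under a ring homomorphism is a subfield as soon as 1 and 0 differ
  in the target, which is where properness of \<open>I\<close> enters.\<close>

lemma subfield_quotient_constants:
  assumes "ideal I (mfps_ring :: ('a::field, 'n::finite) mfps ring)" "I \<noteq> UNIV"
  shows "subfield (range (\<lambda>c. I +>\<^bsub>mfps_ring\<^esub> mfps_const c)) (mfps_ring Quot I)"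
proof -
  let ?F = "ring_of_type_algebra :: 'a ring" and ?R = "mfps_ring :: ('a, 'n) mfps ring"
  interpret I: ideal I ?R by fact
  let ?h = "(\<lambda>x. I +>\<^bsub>?R\<^esub> x) \<circ> mfps_const"
  have "?h \<in> ring_hom ?F (?R Quot I)"
    using mfps_const_ring_hom I.rcos_ring_hom by (rule ring_hom_trans)
  interpret F: field ?F ..
  interpret Q: ring "?R Quot I"
    by (rule I.quotient_is_ring)
  interpret h: ring_hom_ring ?F "?R Quot I" ?h
    using F.ring_axioms Q.ring_axioms \<open>?h \<in> _\<close> by (rule ring_hom_ringI2)
  have "\<one>\<^bsub>?R Quot I\<^esub> \<noteq> \<zero>\<^bsub>?R Quot I\<^esub>"
  proof
    assume "\<one>\<^bsub>?R Quot I\<^esub> = \<zero>\<^bsub>?R Quot I\<^esub>"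
    then have "I +>\<^bsub>?R\<^esub> 1 = I"
      by (simp add: FactRing_def)
    then have "1 \<in> I"
      using I.a_rcos_self[of 1] by simp
    then show False
      using I.one_imp_carrier assms(2) by simp
  qed
  then have "subfield (?h ` carrier ?F) (?R Quot I)"
    using h.img_is_subfield(2)[OF F.carrier_is_subfield] by blast
  then show ?thesis
    by (simp add: ring_of_type_algebra_def comp_def)
qed

text \<open>Bridge between the list-based \<open>Span\<close> in the quotient and
  \<open>mfps.span\<close> upstairs: adjoining \<open>I\<close> to the generators accounts for the
  kernel of \<open>h\<close>. Nothing here needs the constants to form a subfield, so
  \<open>I = UNIV\<close> is covered.\<close>

lemma Span_quotient:
  fixes I :: "('a::field, 'n::finite) mfps set"
  assumes "ideal I mfps_ring"
  defines "h \<equiv> \<lambda>x. I +>\<^bsub>mfps_ring\<^esub> x"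
  shows "ring.Span (mfps_ring Quot I) (range (\<lambda>c. h (mfps_const c))) (map h us) =
    h ` mfps.span (set us \<union> I)"
proof -
  let ?R = "mfps_ring :: ('a, 'n) mfps ring"
  interpret I: ideal I ?R by fact
  interpret Q: ring "?R Quot I"
    by (rule I.quotient_is_ring)
  interpret h: ring_hom_ring ?R "?R Quot I" h
    unfolding h_def by (rule I.rcos_ring_hom_ring)
  have mult: "h x \<otimes>\<^bsub>?R Quot I\<^esub> h y = h (x * y)"
    and add: "h x \<oplus>\<^bsub>?R Quot I\<^esub> h y = h (x + y)" for x y
    using h.hom_mult[of x y] h.hom_add[of x y] by simp_all
  have zero: "h x = \<zero>\<^bsub>?R Quot I\<^esub>" if "x \<in> I" for x
    using that I.a_rcos_const[of x] by (simp add: h_def FactRing_def)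
  show ?thesis
  proof (induction us)
    case Nil
    have "mfps.span I = I" "I \<noteq> {}"
      using mfps_ring_ideal[OF assms(1)] by auto
    then have "h ` mfps.span I = {\<zero>\<^bsub>?R Quot I\<^esub>}"
      using zero by (auto simp del: mfps.span_eq_iff)
    then show ?case
      by simp
  next
    case (Cons u us)
    let ?V = "mfps.span (set us \<union> I)"
    \<comment> \<open>\<open>mfps.span_insert\<close> describes the new span by differences,
      \<open>line_extension\<close> by sums.\<close>
    have V: "{x. \<exists>k. x - mfps_const k * u \<in> ?V} = {mfps_const c * u + y | c y. y \<in> ?V}"
    proof
      show "{x. \<exists>k. x - mfps_const k * u \<in> ?V} \<subseteq> {mfps_const c * u + y | c y. y \<in> ?V}"
      proof
        fix x assume "x \<in> {x. \<exists>k. x - mfps_const k * u \<in> ?V}"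
        then obtain k where "x - mfps_const k * u \<in> ?V"
          by blast
        moreover have "x = mfps_const k * u + (x - mfps_const k * u)"
          by simp
        ultimately show "x \<in> {mfps_const c * u + y | c y. y \<in> ?V}"
          by blast
      qed
    next
      have "mfps_const c * u + y - mfps_const c * u = y" for c y
        by simp
      then show "{mfps_const c * u + y | c y. y \<in> ?V} \<subseteq> {x. \<exists>k. x - mfps_const k * u \<in> ?V}"
        by (smt (verit) mem_Collect_eq subsetI)
    qed
    have "Q.Span (range (\<lambda>c. h (mfps_const c))) (map h (u # us)) =
        Q.line_extension (range (\<lambda>c. h (mfps_const c))) (h u) (h ` ?V)"
      using Cons.IH by (simp only: Q.Span.simps list.map foldr_Cons comp_apply)
    also have "\<dots> = {h (mfps_const c * u + y) | c y. y \<in> ?V}"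
      unfolding Q.line_extension_def set_add_def' r_coset_def
      by (auto simp: mult add)
    also have "\<dots> = h ` {x. \<exists>k. x - mfps_const k * u \<in> ?V}"
      unfolding V by auto
    also have "\<dots> = h ` mfps.span (set (u # us) \<union> I)"
      by (simp add: mfps.span_insert)
    finally show ?case .
  qed
qed

lemma quotient_dim_finite_iff:
  fixes I :: "('a::field, 'n::finite) mfps set"
  assumes "ideal I mfps_ring"
  shows "quotient_dim I < \<infinity> \<longleftrightarrow> (\<exists>S. finite S \<and> mfps.span (S \<union> I) = UNIV)"
proof -
  let ?R = "mfps_ring :: ('a, 'n) mfps ring"
  let ?h = "\<lambda>x. I +>\<^bsub>mfps_ring\<^esub> x"
  let ?K = "range (\<lambda>c. ?h (mfps_const c))"
  interpret I: ideal I ?R by fact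
  interpret Q: ring "?R Quot I"
    by (rule I.quotient_is_ring)
  have carrier: "carrier (?R Quot I) = range ?h"
    by (auto simp: FactRing_def A_RCOSETS_def')
  have "quotient_dim I < \<infinity> \<longleftrightarrow> Q.finite_dimension ?K (carrier (?R Quot I))"
    by (simp add: quotient_dim_def Let_def)
  also have "\<dots> \<longleftrightarrow> (\<exists>S. finite S \<and> mfps.span (S \<union> I) = UNIV)"
  proof
    assume "Q.finite_dimension ?K (carrier (?R Quot I))"
    then obtain n where n: "Q.dimension n ?K (carrier (?R Quot I))"
      by blast
    \<comment> \<open>The rules for \<open>dimension\<close> add one vector at a time; each is a
      coset, so a representative can be chosen for it.\<close>
    have "\<exists>us. E = Q.Span K (map ?h us)" if "Q.dimension n K E" for n K E
      using that
    proof (induction rule: Q.dimension.induct)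
      case zero_dim
      then show ?case by (intro exI[of _ "[]"]) simp
    next
      case (Suc_dim v E n K)
      then obtain us u where "E = Q.Span K (map ?h us)" "v = ?h u"
        using carrier by auto
      then show ?case
        by (intro exI[of _ "u # us"]) simp
    qed
    then obtain us where us: "range ?h = ?h ` mfps.span (set us \<union> I)"
      using n Span_quotient[OF assms] carrier by metis
    have "x \<in> mfps.span (set us \<union> I)" for x
    proof -
      obtain y where y: "y \<in> mfps.span (set us \<union> I)" "?h x = ?h y"
        using us by blast
      \<comment> \<open>Equal cosets only give \<open>x\<close> up to an element of
        \<open>I\<close>, which the span contains anyway.\<close>
      then have "x \<in> ?h y"
        using I.a_rcos_self[of x] by simp
      then obtain i where "i \<in> I" "x = i + y"
        by (auto simp: a_r_coset_def')
      then show ?thesis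
        using y(1) by (auto intro: mfps.span_add mfps.span_base)
    qed
    then show "\<exists>S. finite S \<and> mfps.span (S \<union> I) = UNIV"
      by (intro exI[of _ "set us"]) auto
  next
    assume "\<exists>S. finite S \<and> mfps.span (S \<union> I) = UNIV"
    then obtain S where "finite S" "mfps.span (S \<union> I) = UNIV"
      by blast
    then obtain us where us: "mfps.span (set us \<union> I) = UNIV"
      using finite_list by blast
    show "Q.finite_dimension ?K (carrier (?R Quot I))"
    proof (cases "I = UNIV")
      case True
      then have "carrier (?R Quot I) = {\<zero>\<^bsub>?R Quot I\<^esub>}"
        using carrier I.a_rcos_const by (auto simp: FactRing_def)
      then show ?thesis
        using Q.finite_dimensionI[OF Q.zero_dim] by simp
    next
      case False
      then have "Q.finite_dimension ?K (Q.Span ?K (map ?h us))"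
        using subfield_quotient_constants[OF assms] carrier
        by (intro Q.Span_finite_dimension) auto
      then show ?thesis
        using Span_quotient[OF assms, of us] us carrier by simp
    qed
  qed
  finally show ?thesis .
qed

section \<open>The Jacobian and Tjurina ideals\<close>

lemma ideal_jacobian_ideal: "ideal (jacobian_ideal f) mfps_ring"
  for f :: "('a::comm_ring_1, 'n::finite) mfps"
proof -
  interpret cring "mfps_ring :: ('a, 'n) mfps ring" ..
  show ?thesis
    unfolding jacobian_ideal_def by (rule genideal_ideal) simp
qed

lemma ideal_tjurina_ideal: "ideal (tjurina_ideal f) mfps_ring"
  for f :: "('a::comm_ring_1, 'n::finite) mfps"
proof -
  interpret cring "mfps_ring :: ('a, 'n) mfps ring" ..
  show ?thesis
    unfolding tjurina_ideal_def by (intro add_ideals ideal_jacobian_ideal genideal_ideal) simp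
qed

lemma tjurina_ideal_eq: "tjurina_ideal f = {a * f + j | a j. j \<in> jacobian_ideal f}"
  for f :: "('a::comm_ring_1, 'n::finite) mfps"
proof -
  interpret cring "mfps_ring :: ('a, 'n) mfps ring" ..
  have "Idl\<^bsub>mfps_ring\<^esub> {f} = range (\<lambda>a. a * f)"
    using cgenideal_eq_genideal[of f] by (auto simp: cgenideal_def)
  then show ?thesis
    unfolding tjurina_ideal_def set_add_def' by auto
qed

section \<open>Finite codimension and powers of f\<close>

lemma finite_codim_imp_power_mem:
  fixes f :: "('a::field, 'n::finite) mfps"
  assumes f: "f \<in> mfps_max_ideal" and I: "ideal I mfps_ring"
    and S: "finite S" "mfps.span (S \<union> I) = UNIV"
  shows "\<exists>e. f ^ e \<in> I"
proof -
  note I' = mfps_ring_ideal[OF I]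
  let ?d = "card S"
  \<comment> \<open>The powers are listed downwards from \<open>f ^ ?d\<close> to
    \<open>f ^ 0\<close>, so the predecessors of a power are exactly the higher ones in the
    list.\<close>
  obtain i where i: "i \<le> ?d" "f ^ (?d - i) \<in> mfps.span ((\<lambda>i. f ^ (?d - i)) ` {..<i} \<union> I)"
    using mfps.dependent_mod[OF S, of "\<lambda>i. f ^ (?d - i)"] by blast
  define e where "e = ?d - i"
  \<comment> \<open>All these higher powers are multiples of \<open>f ^ Suc e\<close>;
    \<open>?H\<close> is the ideal generated by \<open>f ^ Suc e\<close> and \<open>I\<close>, and
    it absorbs the whole span.\<close>
  let ?H = "{f ^ Suc e * g + j | g j. j \<in> I}"
  have "mfps.subspace ?H"
  proof (rule mfps.subspaceI)
    show "0 \<in> ?H"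
      using I'(1) by (auto intro: exI[of _ 0])
    fix x y assume "x \<in> ?H" "y \<in> ?H"
    then obtain g j g' j' where "x = f ^ Suc e * g + j" "y = f ^ Suc e * g' + j'" "j \<in> I" "j' \<in> I"
      by blast
    then have "x + y = f ^ Suc e * (g + g') + (j + j')" "j + j' \<in> I"
      using I'(2) by (auto simp: algebra_simps)
    then show "x + y \<in> ?H"
      by blast
  next
    fix c x assume "x \<in> ?H"
    then obtain g j where "x = f ^ Suc e * g + j" "j \<in> I"
      by blast
    then have "mfps_const c * x = f ^ Suc e * (mfps_const c * g) + mfps_const c * j"
      "mfps_const c * j \<in> I"
      using I'(3) by (auto simp: algebra_simps)
    then show "mfps_const c * x \<in> ?H"
      by blast
  qed
  moreover have "(\<lambda>i. f ^ (?d - i)) ` {..<i} \<union> I \<subseteq> ?H"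
  proof -
    have "f ^ (?d - k) = f ^ Suc e * f ^ (i - Suc k) + 0" if "k < i" for k
    proof -
      have "?d - k = Suc e + (i - Suc k)"
        using that i(1) by (simp add: e_def)
      then show ?thesis
        by (simp only: power_add add_0_right)
    qed
    moreover have "j = f ^ Suc e * 0 + j" for j
      by simp
    ultimately show ?thesis
      using I'(1) by blast
  qed
  ultimately have "f ^ e \<in> ?H"
    using i(2) mfps.span_minimal unfolding e_def by blast
  then obtain g j where gj: "f ^ e = f ^ Suc e * g + j" "j \<in> I"
    by blast
  \<comment> \<open>The constant coefficient is 1 because that of \<open>f\<close> vanishes.\<close>
  have "mfps_nth (1 - f * g) 0 \<noteq> 0"
    using f by (simp add: minus_mfps_def one_mfps_def mfps_max_ideal_def)
  then obtain u where u: "u * (1 - f * g) = 1"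
    by (rule mfps_unit)
  have "f ^ e = u * (1 - f * g) * f ^ e"
    by (simp add: u)
  also have "\<dots> = u * (f ^ e - f ^ Suc e * g)"
    by (simp add: algebra_simps)
  also have "f ^ e - f ^ Suc e * g = j"
    using gj(1) by (metis add_diff_cancel_left')
  finally show ?thesis
    using I'(3)[OF gj(2)] by metis
qed

lemma power_mem_imp_finite_codim:
  fixes f :: "('a::field, 'n::finite) mfps"
  assumes I: "ideal I mfps_ring" and f: "f ^ N \<in> I"
    and S: "finite S" "mfps.span (S \<union> {a * f + j | a j. j \<in> I}) = UNIV"
  shows "\<exists>S. finite S \<and> mfps.span (S \<union> I) = UNIV"
proof -
  note I' = mfps_ring_ideal[OF I]
  \<comment> \<open>Only the exponents below \<open>N\<close> are needed, since \<open>f ^ N\<close>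
    already lies in \<open>I\<close>.\<close>
  define S' where "S' = (\<Union>i<N. (*) (f ^ i) ` S)"
  define W where "W = mfps.span (S' \<union> I)"
  have W: "mfps.subspace W"
    unfolding W_def by (rule mfps.subspace_span)
  \<comment> \<open>Downward induction from \<open>i = N\<close> to \<open>i = 0\<close>, where the
    claim says that \<open>W\<close> is everything. \<open>x\<close> stays arbitrary because the
    step applies the hypothesis to a new factor \<open>a\<close>.\<close>
  have "f ^ i * x \<in> W" if "i \<le> N" for i x
    using that
  proof (induction i arbitrary: x rule: inc_induct)
    case base
    have "x * f ^ N \<in> I"
      using f by (rule I'(3))
    then show ?case
      unfolding W_def by (auto intro: mfps.span_base simp: mult.commute)
  next
    case (step i)
    note less = step.hyps and IH = step.IH
    have "x \<in> mfps.span (S \<union> {a * f + j | a j. j \<in> I})"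
      using S(2) by simp
    \<comment> \<open>By linearity it suffices to treat generators: one from \<open>S\<close> lands
      in \<open>S'\<close>, and \<open>a * f + j\<close> gives \<open>f ^ Suc i * a\<close> plus an
      element of \<open>I\<close>.\<close>
    then show ?case
    proof (induction x rule: mfps.span_induct_alt)
      case base
      then show ?case
        using W mfps.subspace_0 by auto
    next
      case (step c x y)
      have "f ^ i * x \<in> W"
        using step(1)
      proof
        assume "x \<in> S"
        then show ?thesis
          unfolding W_def S'_def using less by (auto intro!: mfps.span_base)
      next
        assume "x \<in> {a * f + j | a j. j \<in> I}"
        then obtain a j where "x = a * f + j" "j \<in> I"
          by blast
        then have "f ^ i * x = f ^ Suc i * a + f ^ i * j" "f ^ i * j \<in> W"
          unfolding W_def using I'(3) by (auto simp: algebra_simps intro: mfps.span_base)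
        then show ?thesis
          using mfps.subspace_add[OF W IH] by metis
      qed
      then have "mfps_const c * (f ^ i * x) + f ^ i * y \<in> W"
        using step(2) W by (intro mfps.subspace_add mfps.subspace_scale)
      then show ?case
        by (simp add: algebra_simps)
    qed
  qed
  from this[of 0] have "W = UNIV"
    by auto
  moreover have "finite S'"
    using S(1) by (simp add: S'_def)
  ultimately show ?thesis
    unfolding W_def by blast
qed

theorem proposition2p1:
  fixes f :: "('k::alg_closed_field, 'n::finite) mfps"
  assumes "f \<in> mfps_max_ideal"
    and "tjurina_number f < \<infinity>"
  shows "milnor_number f < \<infinity> \<longleftrightarrow> f \<in> ideal_radical mfps_ring (jacobian_ideal f)"
proof
  note J = ideal_jacobian_ideal[of f]
  {
    assume "milnor_number f < \<infinity>"
    then obtain e where "f ^ e \<in> jacobian_ideal f"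
      using finite_codim_imp_power_mem[OF assms(1) J] quotient_dim_finite_iff[OF J]
      by (auto simp: milnor_number_def)
    \<comment> \<open>The radical asks for a positive exponent, while \<open>e\<close> may be
      0.\<close>
    then have "f ^ Suc e \<in> jacobian_ideal f"
      using mfps_ring_ideal(3)[OF J] by simp
    then show "f \<in> ideal_radical mfps_ring (jacobian_ideal f)"
      unfolding ideal_radical_def by fastforce
  next
    assume "f \<in> ideal_radical mfps_ring (jacobian_ideal f)"
    then obtain N where "f ^ N \<in> jacobian_ideal f"
      by (auto simp: ideal_radical_def)
    moreover obtain S where "finite S" "mfps.span (S \<union> tjurina_ideal f) = UNIV"
      using assms(2) quotient_dim_finite_iff[OF ideal_tjurina_ideal[of f]]
      by (auto simp: tjurina_number_def)
    ultimately show "milnor_number f < \<infinity>"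
      using power_mem_imp_finite_codim[OF J] quotient_dim_finite_iff[OF J]
      by (simp add: milnor_number_def tjurina_ideal_eq)
  }
qed

end
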